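(* There exists an infinite family of measures on $\mathbb{R}$, and there exists an infinite family of measures on $\mathbb{T}$, such that each measure in the family is $n$-adic doubling for every integer $n\ge 2$ but is not doubling.
   Context: $\mathbb{T}$ is the torus $[0,1]$ with the points $0$ and $1$ identified (so intervals in $\mathbb{T}$ are arcs). All intervals are bounded, half-open, containing their left endpoint, of positive length. A measure $\mu$ is doubling if there is a constant $C>0$ (depending only on $\mu$) such that $\mu(I_1)\le C\mu(I_2)$ for any two adjacent intervals $I_1,I_2$ of equal length. For an integer $n\ge 2$, an $n$-adic interval in $\mathbb{R}$ is an interval $\left[\frac{k-1}{n^m},\frac{k}{n^m}\right)$ with $m,k\in\mathbb{Z}$. Its $n$ children are $\left[\frac{k-1}{n^m}+\frac{j-1}{n^{m+1}},\frac{k-1}{n^m}+\frac{j}{n^{m+1}}\right)$, $1\le j\le n$. Two $n$-adic intervals are $n$-adic siblings if they are children of a common $n$-adic interval. On $\mathbb{T}$, the $n$-adic intervals are those contained in $[0,1)$ (hence of length at most $1$). A measure $\mu$ is $n$-adic doubling if there is a constant $C(n)>0$ (allowed to depend on $n$) such that $\mu(J_1)\le C(n)\mu(J_2)$ for all $n$-adic siblings $J_1,J_2$. *)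

theory Defs
  imports "HOL-Analysis.Analysis"
begin

(* The torus is represented by the fundamental domain {0..<1}; the quotient map from {0..1},
   and from the whole line, is frac. *)

definition torus_open :: "real set \<Rightarrow> bool" where
  "torus_open U \<longleftrightarrow> U \<subseteq> {0..<1} \<and> openin (top_of_set {0..1}) {x \<in> {0..1}. frac x \<in> U}"

definition torus_borel :: "real measure" where
  "torus_borel = sigma {0..<1} {U. torus_open U}"

lemma torus_open_subset: "{U. torus_open U} \<subseteq> Pow {0..<1}"
  by (rule subsetI) (simp only: torus_open_def mem_Collect_eq Pow_iff)

lemma space_torus_borel: "space torus_borel = {0..<1}"
  unfolding torus_borel_def by (rule space_measure_of[OF torus_open_subset])

lemma sets_torus_borel: "sets torus_borel = sets (restrict_space borel {0..<1::real})"
proof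
  have sets_eq: "sets torus_borel = sigma_sets {0..<1} {U. torus_open U}"
    unfolding torus_borel_def by (rule sets_measure_of[OF torus_open_subset])
  show "sets torus_borel \<subseteq> sets (restrict_space borel {0..<1::real})"
    unfolding torus_borel_def
  proof -
    have "U \<in> sets (restrict_space borel {0..<1})" if "torus_open U" for U
    proof -
      have "\<exists>V. open V \<and> {x \<in> {0..1}. frac x \<in> U} = {0..1} \<inter> V"
        using that unfolding torus_open_def openin_open by (rule conjunct2)
      then obtain V where V: "open V" "{x \<in> {0..1}. frac x \<in> U} = {0..1} \<inter> V"
        by (elim exE conjE)
      have "x \<in> U \<longleftrightarrow> x \<in> {0..<1} \<inter> V" for x
      proof (cases "x \<in> {0..<1}")
        case True
        then have "frac x = x" by (simp add: frac_eq)
        moreover have "x \<in> {x \<in> {0..1}. frac x \<in> U} \<longleftrightarrow> x \<in> {0..1} \<inter> V"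
          unfolding V(2) by (rule refl)
        moreover have "x \<in> {0..1}" using True by simp
        ultimately have "x \<in> U \<longleftrightarrow> x \<in> V" by (metis (mono_tags, lifting) Int_iff mem_Collect_eq)
        with True show ?thesis by (simp only: Int_iff) simp
      next
        case False
        with that show ?thesis using torus_open_subset by blast
      qed
      then have "U = {0..<1} \<inter> V" by blast
      moreover have "V \<in> sets borel" using V(1) by (rule borel_open)
      ultimately show ?thesis unfolding sets_restrict_space by blast
    qed
    then have "{U. torus_open U} \<subseteq> sets (restrict_space borel {0..<1::real})" by blast
    from sets.sigma_sets_subset[OF this]
    show "sets (sigma {0..<1} {U. torus_open U}) \<subseteq> sets (restrict_space borel {0..<1::real})"
      by (simp add: sets_measure_of[OF torus_open_subset] space_restrict_space)
  qed
  have open_part: "torus_open (V \<inter> {0<..<1})" if "open V" for V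
  proof -
    have "{x \<in> {0..1}. frac x \<in> V \<inter> {0<..<1}} = {0..1} \<inter> (V \<inter> {0<..<1::real})"
    proof (rule set_eqI)
      fix x :: real
      show "x \<in> {x \<in> {0..1}. frac x \<in> V \<inter> {0<..<1}} \<longleftrightarrow> x \<in> {0..1} \<inter> (V \<inter> {0<..<1})"
      proof (cases "x = 1")
        case False
        show ?thesis
        proof (cases "x \<in> {0..<1}")
          case True
          then have "frac x = x" by (simp add: frac_eq)
          then show ?thesis by (simp only: Int_iff mem_Collect_eq)
        next
          case out: False
          with False show ?thesis by auto
        qed
      qed simp
    qed
    moreover have "open (V \<inter> {0<..<1})" using that by (intro open_Int open_greaterThanLessThan)
    moreover have "V \<inter> {0<..<1} \<subseteq> {0..<1}" by auto
    ultimately show ?thesis unfolding torus_open_def openin_open by blast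
  qed
  have "{0} \<in> sets torus_borel"
  proof -
    have "{0<..<1} \<in> sets torus_borel"
      using open_part[of UNIV] unfolding sets_eq by (intro sigma_sets.Basic) simp
    then have "space torus_borel - {0<..<1} \<in> sets torus_borel" by (rule sets.compl_sets)
    moreover have "space torus_borel - {0<..<1} = {0}" by (auto simp: space_torus_borel)
    ultimately show ?thesis by simp
  qed
  then have "V \<inter> {0..<1} \<in> sets torus_borel" if "open V" for V
  proof -
    have "V \<inter> {0<..<1} \<in> sets torus_borel"
      using open_part[OF that] unfolding sets_eq by (intro sigma_sets.Basic) simp
    moreover have "V \<inter> {0} \<in> sets torus_borel"
      using \<open>{0} \<in> sets torus_borel\<close> by (cases "0 \<in> V") simp_all
    ultimately have "(V \<inter> {0<..<1}) \<union> (V \<inter> {0}) \<in> sets torus_borel" by (rule sets.Un)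
    moreover have "{0..<1} = {0<..<1} \<union> {0::real}" by auto
    then have "V \<inter> {0..<1} = (V \<inter> {0<..<1}) \<union> (V \<inter> {0})" by blast
    ultimately show ?thesis by simp
  qed
  then have "(\<lambda>x. x) \<in> borel_measurable torus_borel"
    by (intro borel_measurableI) (simp add: space_torus_borel)
  then show "sets (restrict_space borel {0..<1::real}) \<subseteq> sets torus_borel"
  proof -
    assume id: "(\<lambda>x. x) \<in> borel_measurable torus_borel"
    show ?thesis
    proof
      fix A assume "A \<in> sets (restrict_space borel {0..<1::real})"
      then obtain B :: "real set" where B: "B \<in> sets borel" "A = {0..<1} \<inter> B"
        by (auto simp: sets_restrict_space)
      have "(\<lambda>x. x) -` B \<inter> space torus_borel \<in> sets torus_borel"
        by (rule measurable_sets[OF id B(1)])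
      moreover have "(\<lambda>x. x) -` B \<inter> space torus_borel = A"
        unfolding space_torus_borel B(2) by blast
      ultimately show "A \<in> sets torus_borel" by simp
    qed
  qed
qed

definition line_measure :: "real measure \<Rightarrow> bool" where
  "line_measure \<mu> \<longleftrightarrow> sets \<mu> = sets borel \<and> (\<forall>K. compact K \<longrightarrow> emeasure \<mu> K < \<infinity>)"

(* Finite on compact sets means finite here, since the torus is compact. *)
definition torus_measure :: "real measure \<Rightarrow> bool" where
  "torus_measure \<mu> \<longleftrightarrow> sets \<mu> = sets torus_borel \<and> emeasure \<mu> {0..<1} < \<infinity>"

definition line_adjacent :: "real set \<Rightarrow> real set \<Rightarrow> bool" where
  "line_adjacent I J \<longleftrightarrow> (\<exists>a h. 0 < h \<and>
     (I = {a..<a + h} \<and> J = {a + h..<a + 2 * h} \<or> J = {a..<a + h} \<and> I = {a + h..<a + 2 * h}))"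

(* Arcs may wrap around 0. The bound on h makes the two arcs disjoint. *)
definition torus_adjacent :: "real set \<Rightarrow> real set \<Rightarrow> bool" where
  "torus_adjacent I J \<longleftrightarrow> (\<exists>a h. 0 < h \<and> h \<le> 1 / 2 \<and>
     (I = frac ` {a..<a + h} \<and> J = frac ` {a + h..<a + 2 * h} \<or>
      J = frac ` {a..<a + h} \<and> I = frac ` {a + h..<a + 2 * h}))"

definition nadic_interval :: "nat \<Rightarrow> int \<Rightarrow> int \<Rightarrow> real set" where
  "nadic_interval n m k = {of_int (k - 1) / real n powi m ..< of_int k / real n powi m}"

definition nadic_child :: "nat \<Rightarrow> int \<Rightarrow> int \<Rightarrow> nat \<Rightarrow> real set" where
  "nadic_child n m k j =
     {of_int (k - 1) / real n powi m + (real j - 1) / real n powi (m + 1) ..<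
      of_int (k - 1) / real n powi m + real j / real n powi (m + 1)}"

(* X is the ambient space: UNIV for the line, {0..<1} for the torus. *)
definition nadic_siblings :: "real set \<Rightarrow> nat \<Rightarrow> real set \<Rightarrow> real set \<Rightarrow> bool" where
  "nadic_siblings X n I J \<longleftrightarrow> (\<exists>m k. nadic_interval n m k \<subseteq> X \<and>
     (\<exists>i\<in>{1..n}. \<exists>j\<in>{1..n}. I = nadic_child n m k i \<and> J = nadic_child n m k j))"

definition doubling_wrt :: "(real set \<Rightarrow> real set \<Rightarrow> bool) \<Rightarrow> real measure \<Rightarrow> bool" where
  "doubling_wrt R \<mu> \<longleftrightarrow>
     (\<exists>C::real. 0 < C \<and> (\<forall>I J. R I J \<longrightarrow> emeasure \<mu> I \<le> ennreal C * emeasure \<mu> J))"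

definition line_doubling :: "real measure \<Rightarrow> bool" where
  "line_doubling = doubling_wrt line_adjacent"

definition torus_doubling :: "real measure \<Rightarrow> bool" where
  "torus_doubling = doubling_wrt torus_adjacent"

definition line_nadic_doubling :: "nat \<Rightarrow> real measure \<Rightarrow> bool" where
  "line_nadic_doubling n = doubling_wrt (nadic_siblings UNIV n)"

definition torus_nadic_doubling :: "nat \<Rightarrow> real measure \<Rightarrow> bool" where
  "torus_nadic_doubling n = doubling_wrt (nadic_siblings {0..<1} n)"

end

theory Submission
  imports Defs
begin

text \<open>
  The point \<open>0\<close> is an endpoint of \<open>n\<close>-adic intervals for every \<open>n\<close>, so no \<open>n\<close>-adic
  interval of the line has \<open>0\<close> in its interior, and on the torus none wraps around \<open>0\<close>. The density
  that is \<open>1\<close> on the negative half-line and \<open>x ^ p\<close> on the positive one, with \<open>p \<ge> 1\<close>, is therefore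
  only tested on each side separately, where its values on siblings are comparable in mean with
  constant \<open>2 (2 n) ^ p\<close>. Across \<open>0\<close> doubling fails: \<open>[0, h)\<close> has mass at most \<open>h ^ (p + 1)\<close>, but
  \<open>[-h, 0)\<close> (on the torus \<open>[1 - h, 1)\<close>) has mass of order \<open>h\<close>.
\<close>

section \<open>The measure on the line and bounds for its mass\<close>

definition half_power_measure :: "nat \<Rightarrow> real measure" where
  "half_power_measure p = density lborel (\<lambda>x. ennreal (if x < 0 then 1 else x ^ p))"

lemma sets_half_power_measure [simp]: "sets (half_power_measure p) = sets borel"
  by (simp add: half_power_measure_def)

lemma space_half_power_measure [simp]: "space (half_power_measure p) = UNIV"
  by (simp add: half_power_measure_def)

lemma emeasure_half_power_measure:
  assumes "A \<in> sets borel"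
  shows "emeasure (half_power_measure p) A =
    (\<integral>\<^sup>+x\<in>A. ennreal (if x < 0 then 1 else x ^ p) \<partial>lborel)"
proof -
  have "(\<lambda>x::real. ennreal (if x < 0 then 1 else x ^ p)) \<in> borel_measurable lborel"
    by simp
  then show ?thesis
    unfolding half_power_measure_def by (rule emeasure_density) (simp add: assms)
qed

text \<open>Integrate the constant \<open>c\<close> over the enclosing interval. The bound on the
  density is required only on \<open>A\<close>, which need not be an interval: below it is an n-adic
  child, an initial interval or an arbitrary compact set.\<close>

lemma emeasure_half_power_measure_upper:
  assumes A: "A \<in> sets borel" "A \<subseteq> {a..<b}" and "0 \<le> c" "a \<le> b"
    and le: "\<And>x. x \<in> A \<Longrightarrow> (if x < 0 then 1 else x ^ p) \<le> c"
  shows "emeasure (half_power_measure p) A \<le> ennreal (c * (b - a))"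
proof -
  have "emeasure (half_power_measure p) A \<le> (\<integral>\<^sup>+x. ennreal c * indicator {a..<b} x \<partial>lborel)"
    unfolding emeasure_half_power_measure[OF A(1)]
    using A(2) by (intro nn_integral_mono) (auto simp: ennreal_leI[OF le] split: split_indicator split del: if_split)
  also have "\<dots> = ennreal (c * (b - a))"
    using assms by (simp add: nn_integral_cmult_indicator ennreal_mult)
  finally show ?thesis .
qed

text \<open>Here \<open>A\<close> may exceed the interval, so a part of \<open>A\<close> where the
  density is too small can be discarded.\<close>

lemma emeasure_half_power_measure_lower:
  assumes A: "A \<in> sets borel" "{a..<b} \<subseteq> A" and "0 \<le> c" "a \<le> b"
    and le: "\<And>x. a \<le> x \<Longrightarrow> x < b \<Longrightarrow> c \<le> (if x < 0 then 1 else x ^ p)"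
  shows "ennreal (c * (b - a)) \<le> emeasure (half_power_measure p) A"
proof -
  have "ennreal (c * (b - a)) = (\<integral>\<^sup>+x. ennreal c * indicator {a..<b} x \<partial>lborel)"
    using assms by (simp add: nn_integral_cmult_indicator ennreal_mult)
  also have "\<dots> \<le> emeasure (half_power_measure p) A"
    unfolding emeasure_half_power_measure[OF A(1)]
    using A(2) by (intro nn_integral_mono) (auto simp: ennreal_leI[OF le] split: split_indicator split del: if_split)
  finally show ?thesis .
qed

text \<open>This mass determines \<open>p\<close>, which is what makes the families infinite; it
  also shows that the total mass on the torus is finite.\<close>

lemma emeasure_half_power_measure_unit:
  "emeasure (half_power_measure p) {0..<1} = ennreal (1 / real (Suc p))"
proof -
  \<comment> \<open>Adding the null point 1 gives a closed interval, to which the fundamental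
    theorem of calculus applies.\<close>
  have "emeasure (half_power_measure p) {0..<1} = (\<integral>\<^sup>+x\<in>{0..1}. ennreal (x ^ p) \<partial>lborel)"
    unfolding emeasure_half_power_measure[OF atLeastLessThan_borel]
    using AE_lborel_singleton[of "1::real"]
    by (intro nn_integral_cong_AE) (auto split: split_indicator elim!: eventually_mono)
  also have "\<dots> = ennreal (1 ^ Suc p / real (Suc p) - 0 ^ Suc p / real (Suc p))"
    by (rule nn_integral_FTC_Icc) (auto intro!: derivative_eq_intros simp del: power_Suc)
  finally show ?thesis by simp
qed

lemma inj_half_power_measure_unit: "inj (\<lambda>p. emeasure (half_power_measure p) {0..<1})"
  by (intro injI) (simp add: emeasure_half_power_measure_unit)

section \<open>Comparison of n-adic siblings\<close>

lemma nadic_child_subset: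
  assumes "i \<in> {1..n}"
  shows "nadic_child n m k i \<subseteq> nadic_interval n m k"
proof -
  have n: "real n > 0" using assms by auto
  have eq: "real n powi (m + 1) = real n powi m * real n"
    using n by (simp add: power_int_add)
  have pos: "real n powi m > 0" using n by simp
  have "real i / (real n powi m * real n) \<le> 1 / real n powi m"
    using assms n pos by (simp add: field_simps)
  moreover have "0 \<le> (real i - 1) / (real n powi m * real n)"
    using assms n pos by (intro divide_nonneg_nonneg) auto
  ultimately show ?thesis
    unfolding nadic_child_def nadic_interval_def eq
    by (auto simp: diff_divide_distrib)
qed

text \<open>The ambient set \<open>X\<close> is arbitrary, so the line and the torus are covered at
  once. To the right of 0, bound the density on \<open>I\<close> by its value at the right end of
  the parent, and use only the right half of \<open>J\<close>: the density tends to 0 at the left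
  end of a child \<open>[0, h)\<close> when \<open>p\<close> is positive. Halving \<open>J\<close>
  costs the factor 2, comparing the densities the factor \<open>(2 * real n) ^ p\<close>.\<close>

lemma half_power_measure_siblings:
  assumes "nadic_siblings X n I J"
  shows "emeasure (half_power_measure p) I \<le>
    ennreal (2 * (2 * real n) ^ p) * emeasure (half_power_measure p) J"
proof -
  from assms obtain m k i j where ij: "i \<in> {1..n}" "j \<in> {1..n}"
    and I: "I = nadic_child n m k i" and J: "J = nadic_child n m k j"
    unfolding nadic_siblings_def by auto
  define P where "P = real_of_int (k - 1) / real n powi m"
  define h where "h = 1 / real n powi (m + 1)"
  have n: "real n \<ge> 1" using ij by auto
  then have h: "h > 0" by (simp add: h_def)
  have nh: "P + real n * h = real_of_int k / real n powi m"
    using n by (simp add: P_def h_def power_int_add field_simps)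
  have child: "nadic_child n m k l = {P + (real l - 1) * h ..< P + real l * h}" for l
    by (simp add: nadic_child_def P_def h_def)
  have cbounds: "P \<le> P + (real l - 1) * h" "P + real l * h \<le> P + real n * h"
    if "l \<in> {1..n}" for l using that h by auto
  have meas: "I \<in> sets borel" "J \<in> sets borel"
    by (simp_all add: I J child)
  show ?thesis
  \<comment> \<open>As \<open>k\<close> is an integer, either the left end
    \<open>(k - 1) / n ^ m\<close> of the parent is nonnegative or its right end
    \<open>k / n ^ m\<close> is nonpositive.\<close>
  proof (cases "k \<ge> 1")
    case True
    then have P: "P \<ge> 0" using n by (simp add: P_def)
    have "emeasure (half_power_measure p) I \<le>
        ennreal ((P + real n * h) ^ p * ((P + real i * h) - (P + (real i - 1) * h)))"
    proof (rule emeasure_half_power_measure_upper)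
      show "(if x < 0 then 1 else x ^ p) \<le> (P + real n * h) ^ p" if "x \<in> I" for x
        using that P cbounds[OF ij(1)] by (auto simp: I child intro: power_mono)
    qed (use meas P h in \<open>auto simp: I child intro: mult_right_mono\<close>)
    also have "\<dots> = ennreal ((P + real n * h) ^ p * h)"
      by (simp add: algebra_simps)
    \<comment> \<open>The right side expands to \<open>2 * n * P + n * h\<close> inside the
      power.\<close>
    also have "\<dots> \<le> ennreal ((2 * real n * (P + h / 2)) ^ p * h)"
    proof (intro ennreal_leI mult_right_mono power_mono)
      have "P * 1 \<le> P * (2 * real n)" using P n by (intro mult_left_mono) auto
      then show "P + real n * h \<le> 2 * real n * (P + h / 2)" by (simp add: algebra_simps)
    qed (use P h n in auto)
    also have "\<dots> = ennreal (2 * (2 * real n) ^ p) * ennreal ((P + h / 2) ^ p * (h / 2))"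
      using P h n by (subst ennreal_mult[symmetric]) (auto simp: power_mult_distrib)
    also have "ennreal ((P + h / 2) ^ p * (h / 2)) \<le> emeasure (half_power_measure p) J"
    proof -
      \<comment> \<open>\<open>?a\<close> is the midpoint of \<open>J\<close>; since
        \<open>j\<close> is at least 1, it is at least \<open>P + h / 2\<close>.\<close>
      let ?a = "P + (real j - 1 / 2) * h" and ?b = "P + real j * h"
      have a: "P + h / 2 \<le> ?a" using ij(2) h by (auto simp: algebra_simps)
      have "ennreal ((P + h / 2) ^ p * (?b - ?a)) \<le> emeasure (half_power_measure p) J"
      proof (rule emeasure_half_power_measure_lower)
        show "{?a..<?b} \<subseteq> J" using h by (auto simp: J child algebra_simps)
        show "(P + h / 2) ^ p \<le> (if x < 0 then 1 else x ^ p)" if "?a \<le> x" for x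
        proof -
          have "P + h / 2 \<le> x" using a that by (rule order_trans)
          moreover have "0 \<le> P + h / 2" using P h by simp
          ultimately show ?thesis using power_mono[of "P + h / 2" x p] by auto
        qed
      qed (use meas P h in \<open>auto simp: algebra_simps\<close>)
      moreover have "?b - ?a = h / 2" by (simp add: algebra_simps)
      ultimately show ?thesis by (simp only:)
    qed
    finally show ?thesis by (simp add: mult_left_mono)
  next
    case False
    then have "P + real n * h \<le> 0" using n by (simp add: nh divide_nonpos_pos)
    then have neg: "P + real l * h \<le> 0" if "l \<in> {1..n}" for l
      using cbounds(2)[OF that] by linarith
    \<comment> \<open>To the left of 0 the density is 1, so both siblings have mass
      \<open>h\<close>.\<close>
    have "emeasure (half_power_measure p) I \<le>
        ennreal (1 * ((P + real i * h) - (P + (real i - 1) * h)))"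
      using neg[OF ij(1)] meas(1) h
      by (intro emeasure_half_power_measure_upper) (auto simp: I child intro!: mult_right_mono)
    also have "\<dots> = ennreal (1 * ((P + real j * h) - (P + (real j - 1) * h)))"
      by (simp add: algebra_simps)
    also have "\<dots> \<le> emeasure (half_power_measure p) J"
      using neg[OF ij(2)] meas(2) h
      by (intro emeasure_half_power_measure_lower) (auto simp: J child intro!: mult_right_mono)
    also have "\<dots> = ennreal 1 * emeasure (half_power_measure p) J" by simp
    also have "\<dots> \<le> ennreal (2 * (2 * real n) ^ p) * emeasure (half_power_measure p) J"
    proof (intro mult_right_mono ennreal_leI)
      have "1 \<le> (2 * real n) ^ p" using n by (intro one_le_power) simp
      then show "1 \<le> 2 * (2 * real n) ^ p" by simp
    qed simp
    finally show ?thesis .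
  qed
qed

section \<open>Small mass immediately to the right of 0\<close>

lemma half_power_measure_initial:
  assumes "1 \<le> p" "0 < h" "h \<le> 1"
  shows "emeasure (half_power_measure p) {0..<h} \<le> ennreal (h * h)"
proof -
  \<comment> \<open>A crude bound uniform in \<open>p\<close>: it suffices that the mass is
    quadratic in \<open>h\<close> while the mass on the other side of 0 is linear.\<close>
  have "x ^ p \<le> h" if "0 \<le> x" "x < h" for x
  proof -
    have "x ^ p \<le> x ^ 1" using that assms by (intro power_decreasing) auto
    with that show ?thesis by simp
  qed
  with assms have "emeasure (half_power_measure p) {0..<h} \<le> ennreal (h * (h - 0))"
    by (intro emeasure_half_power_measure_upper) auto
  then show ?thesis by simp
qed

text \<open>\<open>c\<close> stands for a lower bound of the density on the interval or arc of
  length \<open>h\<close> that ends at 0: it is 1 on the line and \<open>(1 / 2) ^ p\<close> on the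
  torus. The mass of \<open>[0, h)\<close> is at most \<open>h * h\<close>, so
  \<open>C * h < c\<close> is enough.\<close>

lemma half_power_measure_no_constant:
  assumes "1 \<le> p" "0 < C" "0 < c"
  obtains h where "0 < h" "h \<le> 1 / 2"
    "ennreal C * emeasure (half_power_measure p) {0..<h} < ennreal (c * h)"
proof
  \<comment> \<open>The second entry gives \<open>C * h\<close> at most \<open>c / 2\<close>; the
    first meets the length bound for adjacent arcs.\<close>
  define h where "h = min (1 / 2) (c / (2 * C))"
  show h: "0 < h" "h \<le> 1 / 2" using assms by (auto simp: h_def)
  have "C * h \<le> C * (c / (2 * C))" using assms by (intro mult_left_mono) (auto simp: h_def)
  also have "\<dots> < c" using assms by simp
  finally have "C * h * h < c * h" using h by (intro mult_strict_right_mono)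
  have "ennreal C * emeasure (half_power_measure p) {0..<h} \<le> ennreal C * ennreal (h * h)"
    using assms h by (intro mult_left_mono half_power_measure_initial) auto
  also have "\<dots> = ennreal (C * h * h)"
    using assms h by (simp add: ennreal_mult mult.assoc)
  also have "\<dots> < ennreal (c * h)"
    using \<open>C * h * h < c * h\<close> assms h by (intro ennreal_lessI) auto
  finally show "ennreal C * emeasure (half_power_measure p) {0..<h} < ennreal (c * h)" .
qed

section \<open>The measures on the line\<close>

lemma line_measure_half_power_measure: "line_measure (half_power_measure p)"
  unfolding line_measure_def
proof (intro conjI allI impI)
  fix K :: "real set" assume K: "compact K"
  then obtain B where B: "B > 0" "\<And>x. x \<in> K \<Longrightarrow> \<bar>x\<bar> \<le> B"
    using compact_imp_bounded[OF K] unfolding bounded_pos by auto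
  \<comment> \<open>\<open>K\<close> may contain \<open>B\<close>, so the half-open interval is
    extended to \<open>B + 1\<close>; the constant \<open>1 + B ^ p\<close> dominates both branches
    of the density.\<close>
  have "emeasure (half_power_measure p) K \<le> ennreal ((1 + B ^ p) * ((B + 1) - (- B)))"
  proof (rule emeasure_half_power_measure_upper)
    show "K \<subseteq> {- B..<B + 1}" using B(2) by force
    show "(if x < 0 then 1 else x ^ p) \<le> 1 + B ^ p" if "x \<in> K" for x
    proof -
      have "0 \<le> B ^ p" using B(1) by simp
      moreover have "x ^ p \<le> B ^ p" if "\<not> x < 0"
        using B(2)[OF \<open>x \<in> K\<close>] that by (intro power_mono) auto
      ultimately show ?thesis by (smt (verit))
    qed
  qed (use B(1) borel_compact[OF K] in simp_all)
  then show "emeasure (half_power_measure p) K < \<infinity>"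
    by (rule le_less_trans) simp
qed simp

lemma line_nadic_doubling_half_power_measure:
  assumes "1 \<le> n"
  shows "line_nadic_doubling n (half_power_measure p)"
  unfolding line_nadic_doubling_def doubling_wrt_def
  using assms half_power_measure_siblings by (intro exI[of _ "2 * (2 * real n) ^ p"]) auto

lemma not_line_doubling_half_power_measure:
  assumes "1 \<le> p"
  shows "\<not> line_doubling (half_power_measure p)"
proof
  assume "line_doubling (half_power_measure p)"
  then obtain C where C: "0 < C"
    and dbl: "\<And>I J. line_adjacent I J \<Longrightarrow>
      emeasure (half_power_measure p) I \<le> ennreal C * emeasure (half_power_measure p) J"
    unfolding line_doubling_def doubling_wrt_def by blast
  obtain h where h: "0 < h" "h \<le> 1 / 2"
    and less: "ennreal C * emeasure (half_power_measure p) {0..<h} < ennreal (1 * h)"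
    using half_power_measure_no_constant[OF assms C zero_less_one] .
  have "ennreal (1 * (0 - (- h))) \<le> emeasure (half_power_measure p) {- h..<0}"
    using h by (intro emeasure_half_power_measure_lower) auto
  moreover have "line_adjacent {- h..<0} {0..<h}"
    unfolding line_adjacent_def using h by (intro exI[of _ "- h"] exI[of _ h]) auto
  ultimately show False using dbl less by (fastforce dest: leD)
qed

section \<open>The measures on the torus\<close>

definition torus_power_measure :: "nat \<Rightarrow> real measure" where
  "torus_power_measure p = restrict_space (half_power_measure p) {0..<1}"

lemma emeasure_torus_power_measure:
  "A \<subseteq> {0..<1} \<Longrightarrow> emeasure (torus_power_measure p) A = emeasure (half_power_measure p) A"
  unfolding torus_power_measure_def by (rule emeasure_restrict_space) auto

lemma torus_measure_torus_power_measure: "torus_measure (torus_power_measure p)"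
proof -
  have "sets (torus_power_measure p) = sets torus_borel"
    unfolding torus_power_measure_def sets_torus_borel by (rule sets_restrict_space_cong) simp
  then show ?thesis
    by (simp add: torus_measure_def emeasure_torus_power_measure emeasure_half_power_measure_unit)
qed

lemma torus_nadic_doubling_torus_power_measure:
  assumes "1 \<le> n"
  shows "torus_nadic_doubling n (torus_power_measure p)"
proof -
  have "emeasure (torus_power_measure p) I \<le>
      ennreal (2 * (2 * real n) ^ p) * emeasure (torus_power_measure p) J"
    if "nadic_siblings {0..<1} n I J" for I J
  proof -
    \<comment> \<open>Siblings lie in their parent, hence in the fundamental domain, where both
      measures agree.\<close>
    have "I \<subseteq> {0..<1}" "J \<subseteq> {0..<1}"
      using that nadic_child_subset unfolding nadic_siblings_def by blast+
    with half_power_measure_siblings[OF that] show ?thesis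
      by (simp add: emeasure_torus_power_measure)
  qed
  then show ?thesis
    unfolding torus_nadic_doubling_def doubling_wrt_def
    using assms by (intro exI[of _ "2 * (2 * real n) ^ p"]) auto
qed

text \<open>On the circle the density \<open>x ^ p\<close> jumps from 1 to 0 across the point 0, so
  the arcs of length \<open>h\<close> on its two sides violate every constant.\<close>

lemma not_torus_doubling_torus_power_measure:
  assumes "1 \<le> p"
  shows "\<not> torus_doubling (torus_power_measure p)"
proof
  assume "torus_doubling (torus_power_measure p)"
  then obtain C where C: "0 < C"
    and dbl: "\<And>I J. torus_adjacent I J \<Longrightarrow>
      emeasure (torus_power_measure p) I \<le> ennreal C * emeasure (torus_power_measure p) J"
    unfolding torus_doubling_def doubling_wrt_def by blast
  have "(0::real) < (1 / 2) ^ p" by simp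
  then obtain h where h: "0 < h" "h \<le> 1 / 2"
    and less: "ennreal C * emeasure (half_power_measure p) {0..<h} < ennreal ((1 / 2) ^ p * h)"
    using half_power_measure_no_constant[OF assms C] by blast
  \<comment> \<open>As \<open>h\<close> is at most 1/2, the arc \<open>[1 - h, 1)\<close> lies in
    \<open>[1/2, 1)\<close>, where the density is at least \<open>(1 / 2) ^ p\<close>.\<close>
  have "ennreal ((1 / 2) ^ p * (1 - (1 - h))) \<le> emeasure (half_power_measure p) {1 - h..<1}"
    using h by (intro emeasure_half_power_measure_lower) (auto intro!: power_mono)
  also have "\<dots> = emeasure (torus_power_measure p) {1 - h..<1}"
    using h by (subst emeasure_torus_power_measure) auto
  also have "\<dots> \<le> ennreal C * emeasure (torus_power_measure p) {0..<h}"
  proof (rule dbl)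
    have "frac ` {1 - h..<1} = (\<lambda>x. x) ` {1 - h..<1}"
      using h by (intro image_cong refl) (auto simp: frac_eq)
    then have 1: "frac ` {1 - h..<1 - h + h} = {1 - h..<1}" by simp
    \<comment> \<open>The second arc starts at 1, which is the point 0 of the torus, and
      \<open>frac\<close> is translation by -1 there.\<close>
    have "frac ` {1..<1 + h} = (+) (- 1) ` {1..<1 + h}"
      using h by (intro image_cong refl) (auto simp: frac_unique_iff)
    also have "\<dots> = {0..<h}"
      unfolding image_add_atLeastLessThan by simp
    finally have 2: "frac ` {1 - h + h..<1 - h + 2 * h} = {0..<h}" by (simp add: add.commute)
    show "torus_adjacent {1 - h..<1} {0..<h}"
      unfolding torus_adjacent_def using h 1 2
      by (intro exI[of _ "1 - h"] exI[of _ h]) auto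
  qed
  also have "\<dots> = ennreal C * emeasure (half_power_measure p) {0..<h}"
    using h by (subst emeasure_torus_power_measure) auto
  finally show False using less by simp
qed

theorem theorem1p1:
  "(\<exists>F :: real measure set. infinite F \<and>
      (\<forall>\<mu>\<in>F. line_measure \<mu> \<and> (\<forall>n\<ge>2. line_nadic_doubling n \<mu>) \<and> \<not> line_doubling \<mu>)) \<and>
   (\<exists>F :: real measure set. infinite F \<and>
      (\<forall>\<mu>\<in>F. torus_measure \<mu> \<and> (\<forall>n\<ge>2. torus_nadic_doubling n \<mu>) \<and> \<not> torus_doubling \<mu>))"
proof -
  \<comment> \<open>The mass of \<open>{0..<1}\<close> recovers \<open>p\<close>, so
    \<open>f\<close> is injective. The index starts at 1 because \<open>p = 0\<close> gives Lebesgue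
    measure, which is doubling.\<close>
  have inf: "infinite (f ` {1..})"
    if "\<And>p. emeasure (f p) {0..<1::real} = emeasure (half_power_measure p) {0..<1}"
    for f :: "nat \<Rightarrow> real measure"
  proof -
    have "inj f"
      using inj_half_power_measure_unit by (metis injD injI that)
    then show ?thesis
      using infinite_Ici[of "1::nat"] finite_imageD inj_on_subset subset_UNIV by blast
  qed
  show ?thesis
  proof (intro conjI)
    show "\<exists>F :: real measure set. infinite F \<and>
        (\<forall>\<mu>\<in>F. line_measure \<mu> \<and> (\<forall>n\<ge>2. line_nadic_doubling n \<mu>) \<and> \<not> line_doubling \<mu>)"
      using inf[of half_power_measure] line_measure_half_power_measure
        line_nadic_doubling_half_power_measure not_line_doubling_half_power_measure
      by (intro exI[of _ "half_power_measure ` {1..}"]) auto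
    show "\<exists>F :: real measure set. infinite F \<and>
        (\<forall>\<mu>\<in>F. torus_measure \<mu> \<and> (\<forall>n\<ge>2. torus_nadic_doubling n \<mu>) \<and> \<not> torus_doubling \<mu>)"
      using inf[of torus_power_measure] emeasure_torus_power_measure
        torus_measure_torus_power_measure torus_nadic_doubling_torus_power_measure
        not_torus_doubling_torus_power_measure
      by (intro exI[of _ "torus_power_measure ` {1..}"]) auto
  qed
qed

end
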